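(* Let $h,\tau\in(0,1)$ with $T/\tau\in\mathbb{N}$, and let $\nu_h\ge 0$ be such that for each $i=1,\dots,d$ $$\nu_h+\Sigma_i(t,x)\ge h\,|f_i(t,x,a,b)|\ \text{ for all }(t,x,a,b),\qquad d\,\nu_h+\sup_{(t,x)\in\Omega^{\tau,h}_T}\sum_{i=1}^d\Sigma_i(t,x)\le \frac{h^2}{\tau},$$ and such that $$d\tau\Big(\max_{i=1,\dots,d}\|\Sigma_i\|_\infty\Big)\le 4h^2,\qquad 96\,\tau\max\{\|c\|_\infty^2,\,2d\|f\|_\infty^2\}\le \min_{i=1,\dots,d}\inf_{(t,x)}\Sigma_i(t,x)+\nu_h .$$ Let $\Lambda^h>\lambda^h\ge\nu_h$ be such that $0<\lambda^h\le \Sigma_i+\nu_h\le\Lambda^h$ for each $i\in\{1,\dots,d\}$. Let $V^{\tau,h}$ be the solution of the discrete equation and $(V^{\tau,h}_n)_{n\ge0}$ the policy iteration sequence described in the context. Then, for all $n\ge1$, $$\sup_{(t,x)\in\Omega^{\tau,h}_T}\big|V^{\tau,h}_n(t,x)-V^{\tau,h}(t,x)\big|^2\le C_h\,2^{-n-1},$$ where $C_h:=e^{C_1T/\lambda^h}\big(12\|g\|_\infty^2+T\lambda^h\big)$ and $C_1:=48\max\{\|c\|_\infty^2,\,2d\|f\|_\infty^2\}$.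
   Context: Fix $T>0$, $d,m_\alpha,m_\beta\in\mathbb{N}$ and compact sets $A\subseteq\mathbb{R}^{m_\alpha}$, $B\subseteq\mathbb{R}^{m_\beta}$. Let $c:[0,T]\times\mathbb{R}^d\times A\times B\to\mathbb{R}$, $f=(f_1,\dots,f_d):[0,T]\times\mathbb{R}^d\times A\times B\to\mathbb{R}^d$, $g:\mathbb{R}^d\to\mathbb{R}$ and $\sigma=\mathrm{diag}(\sigma_1,\dots,\sigma_d):[0,T]\times\mathbb{R}^d\to\mathbb{R}^{d\times d}$ be uniformly bounded, and $\Sigma_i:=\sigma_i^2$. $\|\cdot\|_\infty$ is the supremum norm (of the Euclidean norm for vector-valued functions). Set $L(t,x,p)(a,b):=c(t,x,a,b)+p\cdot f(t,x,a,b)$ and $H(t,x,p):=\sup_{b\in B}\inf_{a\in A}L(t,x,p)(a,b)$. It is assumed throughout that for all $(t,x)$ (in the grid), $p$ and $b$ there is a minimizer $\alpha_b(t,x,p)\in\arg\min_{a\in A}L(t,x,p)(a,b)$ and that, for one fixed selection $\alpha_b$, $\arg\max_{b\in B}L(t,x,p)(\alpha_b(t,x,p),b)$ is nonempty. No uniqueness or regularity of these selections is assumed. Grid: $\mathbb{N}^\tau_T:=\{0,\tau,2\tau,\dots,T\}$, $\mathbb{Z}^d_h:=h\mathbb{Z}^d$, $\Omega^{\tau,h}_T:=\mathbb{N}^\tau_T\times\mathbb{Z}^d_h$. Difference operators ($e_i$ the standard basis): $\partial_t^\tau\varphi(t,x):=\frac{\varphi(t,x)-\varphi(t-\tau,x)}{\tau}$;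 $\nabla^h\varphi(t,x):=\big(\frac{\varphi(t,x+he_i)-\varphi(t,x-he_i)}{2h}\big)_{1\le i\le d}$; $\Delta_i^h\varphi(t,x):=\frac{\varphi(t,x+he_i)-2\varphi(t,x)+\varphi(t,x-he_i)}{h^2}$. Equations containing $\partial^\tau_t$ are imposed at the grid points with $t\in\{\tau,2\tau,\dots,T\}$; they are explicit schemes solved backwards from $t=T$. $V^{\tau,h}:\Omega^{\tau,h}_T\to\mathbb{R}$ solves $$\partial_t^\tau V^{\tau,h}+H(t,x,\nabla^hV^{\tau,h})=-\tfrac12\sum_{i=1}^d(\Sigma_i(t,x)+\nu_h)\Delta_i^hV^{\tau,h},\qquad V^{\tau,h}(T,\cdot)=g\ \text{on }\mathbb{Z}^d_h.$$ Policy iteration: given Lipschitz continuous functions $\alpha_0=\alpha_0(t,x)\in A$, $\beta_0=\beta_0(t,x)\in B$, for $n=0,1,\dots$ let $V_n^{\tau,h}:\Omega^{\tau,h}_T\to\mathbb{R}$ solve $$\partial_t^\tau V_n^{\tau,h}+L(t,x,\nabla^hV_n^{\tau,h})(\alpha_n,\beta_n)=-\tfrac12\sum_{i=1}^d(\Sigma_i(t,x)+\nu_h)\Delta_i^hV_n^{\tau,h},\qquad V_n^{\tau,h}(T,\cdot)=g\ \text{on }\mathbb{Z}^d_h,$$ and then, for $(t,x)\in\Omega^{\tau,h}_T$, choose (any selection) $\alpha_{n+1,b}(t,x)\in\arg\min_{a\in A}L(t,x,\nabla^hV_n^{\tau,h}(t,x))(a,b)$ for each $b\in B$, $\beta_{n+1}(t,x)\in\arg\max_{b\in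 B}L(t,x,\nabla^hV_n^{\tau,h}(t,x))(\alpha_{n+1,b}(t,x),b)$, and $\alpha_{n+1}(t,x):=\alpha_{n+1,\beta_{n+1}(t,x)}(t,x)$. *)

theory Defs
  imports "HOL-Analysis.Analysis"
begin

text \<open>
  Functions of the paper's partial domains (a grid, \<open>[0,T] \<times> \<real>\<^sup>d\<close>, \<open>[0,T] \<times> \<real>\<^sup>d \<times> A \<times> B\<close>) are
  total curried functions here; only their values on the intended domain are ever constrained
  or used. Time is a real number, and \<open>\<real>\<^sup>d\<close> is \<open>real ^ 'd\<close>.
\<close>

definition sup_norm :: "'z set \<Rightarrow> ('z \<Rightarrow> 'v::real_normed_vector) \<Rightarrow> real" where
  "sup_norm S F = (SUP z\<in>S. norm (F z))"

definition lagrangian ::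
  "(real \<Rightarrow> real^'d \<Rightarrow> real^'ma \<Rightarrow> real^'mb \<Rightarrow> real)
   \<Rightarrow> (real \<Rightarrow> real^'d \<Rightarrow> real^'ma \<Rightarrow> real^'mb \<Rightarrow> real^'d)
   \<Rightarrow> real \<Rightarrow> real^'d \<Rightarrow> real^'d \<Rightarrow> real^'ma \<Rightarrow> real^'mb \<Rightarrow> real" where
  "lagrangian c f t x p a b = c t x a b + p \<bullet> f t x a b"

definition hamiltonian ::
  "(real \<Rightarrow> real^'d \<Rightarrow> real^'ma \<Rightarrow> real^'mb \<Rightarrow> real)
   \<Rightarrow> (real \<Rightarrow> real^'d \<Rightarrow> real^'ma \<Rightarrow> real^'mb \<Rightarrow> real^'d)
   \<Rightarrow> (real^'ma) set \<Rightarrow> (real^'mb) set \<Rightarrow> real \<Rightarrow> real^'d \<Rightarrow> real^'d \<Rightarrow> real" where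
  "hamiltonian c f A B t x p = (SUP b\<in>B. INF a\<in>A. lagrangian c f t x p a b)"

definition diffusion :: "(real \<Rightarrow> real^'d \<Rightarrow> real^'d^'d) \<Rightarrow> 'd \<Rightarrow> real \<Rightarrow> real^'d \<Rightarrow> real" where
  "diffusion \<sigma> i t x = (\<sigma> t x $ i $ i)\<^sup>2"

definition time_grid :: "real \<Rightarrow> real \<Rightarrow> real set" where
  "time_grid \<tau> T = {real k * \<tau> |k::nat. real k * \<tau> \<le> T}"

definition space_grid :: "real \<Rightarrow> (real^'d) set" where
  "space_grid h = {x. \<forall>i. \<exists>k::int. x $ i = h * of_int k}"

definition st_grid :: "real \<Rightarrow> real \<Rightarrow> real \<Rightarrow> (real \<times> (real^'d)) set" where
  "st_grid \<tau> h T = time_grid \<tau> T \<times> space_grid h"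

definition time_diff :: "real \<Rightarrow> (real \<Rightarrow> real^'d \<Rightarrow> real) \<Rightarrow> real \<Rightarrow> real^'d \<Rightarrow> real" where
  "time_diff \<tau> \<phi> t x = (\<phi> t x - \<phi> (t - \<tau>) x) / \<tau>"

definition grad_h :: "real \<Rightarrow> (real \<Rightarrow> real^'d \<Rightarrow> real) \<Rightarrow> real \<Rightarrow> real^'d \<Rightarrow> real^'d" where
  "grad_h h \<phi> t x =
     (\<chi> i. (\<phi> t (x + h *\<^sub>R axis i 1) - \<phi> t (x - h *\<^sub>R axis i 1)) / (2 * h))"

definition lap_h :: "real \<Rightarrow> 'd \<Rightarrow> (real \<Rightarrow> real^'d \<Rightarrow> real) \<Rightarrow> real \<Rightarrow> real^'d \<Rightarrow> real" where
  "lap_h h i \<phi> t x =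
     (\<phi> t (x + h *\<^sub>R axis i 1) - 2 * \<phi> t x + \<phi> t (x - h *\<^sub>R axis i 1)) / h\<^sup>2"

text \<open>
  The explicit backward scheme with a general first-order term \<open>F t x (\<nabla>\<^sup>h V)\<close>: both the discrete
  Hamilton--Jacobi equation (\<open>F\<close> the Hamiltonian) and each linear equation of policy iteration
  (\<open>F\<close> the Lagrangian at the current policies) are instances. The equation is imposed at
  \<open>t = \<tau>, 2\<tau>, \<dots>, T\<close> only.
\<close>
definition solves_scheme ::
  "(real \<Rightarrow> real^'d \<Rightarrow> real^'d^'d) \<Rightarrow> (real^'d \<Rightarrow> real) \<Rightarrow> real \<Rightarrow> real \<Rightarrow> real \<Rightarrow> real
   \<Rightarrow> (real \<Rightarrow> real^'d \<Rightarrow> real^'d \<Rightarrow> real) \<Rightarrow> (real \<Rightarrow> real^'d \<Rightarrow> real) \<Rightarrow> bool" where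
  "solves_scheme \<sigma> g T \<tau> h \<nu> F V \<longleftrightarrow>
     (\<forall>t \<in> time_grid \<tau> T - {0}. \<forall>x \<in> space_grid h.
        time_diff \<tau> V t x + F t x (grad_h h V t x)
          = - (1/2) * (\<Sum>i\<in>UNIV. (diffusion \<sigma> i t x + \<nu>) * lap_h h i V t x)) \<and>
     (\<forall>x \<in> space_grid h. V T x = g x)"

text \<open>
  \<open>\<alpha>s (Suc n) t x b\<close> is the minimizer \<open>\<alpha>\<^bsub>n+1,b\<^esub>(t,x)\<close>; the value \<open>\<alpha>s 0\<close> is not used. The initial
  policies are \<open>\<alpha> 0\<close> and \<open>\<beta> 0\<close>.
\<close>
definition policy_iteration ::
  "(real \<Rightarrow> real^'d \<Rightarrow> real^'ma \<Rightarrow> real^'mb \<Rightarrow> real)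
   \<Rightarrow> (real \<Rightarrow> real^'d \<Rightarrow> real^'ma \<Rightarrow> real^'mb \<Rightarrow> real^'d)
   \<Rightarrow> (real \<Rightarrow> real^'d \<Rightarrow> real^'d^'d) \<Rightarrow> (real^'d \<Rightarrow> real)
   \<Rightarrow> (real^'ma) set \<Rightarrow> (real^'mb) set \<Rightarrow> real \<Rightarrow> real \<Rightarrow> real \<Rightarrow> real
   \<Rightarrow> (nat \<Rightarrow> real \<Rightarrow> real^'d \<Rightarrow> real^'mb \<Rightarrow> real^'ma)
   \<Rightarrow> (nat \<Rightarrow> real \<Rightarrow> real^'d \<Rightarrow> real^'ma) \<Rightarrow> (nat \<Rightarrow> real \<Rightarrow> real^'d \<Rightarrow> real^'mb)
   \<Rightarrow> (nat \<Rightarrow> real \<Rightarrow> real^'d \<Rightarrow> real) \<Rightarrow> bool" where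
  "policy_iteration c f \<sigma> g A B T \<tau> h \<nu> \<alpha>s \<alpha> \<beta> Vn \<longleftrightarrow>
     (\<forall>n. solves_scheme \<sigma> g T \<tau> h \<nu>
            (\<lambda>t x p. lagrangian c f t x p (\<alpha> n t x) (\<beta> n t x)) (Vn n)) \<and>
     (\<forall>n. \<forall>(t, x) \<in> st_grid \<tau> h T.
        (\<forall>b\<in>B. is_arg_min (\<lambda>a. lagrangian c f t x (grad_h h (Vn n) t x) a b)
                  (\<lambda>a. a \<in> A) (\<alpha>s (Suc n) t x b)) \<and>
        is_arg_max (\<lambda>b. lagrangian c f t x (grad_h h (Vn n) t x) (\<alpha>s (Suc n) t x b) b)
          (\<lambda>b. b \<in> B) (\<beta> (Suc n) t x) \<and>
        \<alpha> (Suc n) t x = \<alpha>s (Suc n) t x (\<beta> (Suc n) t x))"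

definition data_bound ::
  "(real \<Rightarrow> real^'d \<Rightarrow> real^'ma \<Rightarrow> real^'mb \<Rightarrow> real)
   \<Rightarrow> (real \<Rightarrow> real^'d \<Rightarrow> real^'ma \<Rightarrow> real^'mb \<Rightarrow> real^'d)
   \<Rightarrow> (real^'ma) set \<Rightarrow> (real^'mb) set \<Rightarrow> real \<Rightarrow> real" where
  "data_bound c f A B T =
     max ((sup_norm ({0..T} \<times> UNIV \<times> A \<times> B) (\<lambda>(t, x, a, b). c t x a b))\<^sup>2)
         (2 * real CARD('d) * (sup_norm ({0..T} \<times> UNIV \<times> A \<times> B) (\<lambda>(t, x, a, b). f t x a b))\<^sup>2)"

definition const_C1 ::
  "(real \<Rightarrow> real^'d \<Rightarrow> real^'ma \<Rightarrow> real^'mb \<Rightarrow> real)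
   \<Rightarrow> (real \<Rightarrow> real^'d \<Rightarrow> real^'ma \<Rightarrow> real^'mb \<Rightarrow> real^'d)
   \<Rightarrow> (real^'ma) set \<Rightarrow> (real^'mb) set \<Rightarrow> real \<Rightarrow> real" where
  "const_C1 c f A B T = 48 * data_bound c f A B T"

definition const_Ch ::
  "(real \<Rightarrow> real^'d \<Rightarrow> real^'ma \<Rightarrow> real^'mb \<Rightarrow> real)
   \<Rightarrow> (real \<Rightarrow> real^'d \<Rightarrow> real^'ma \<Rightarrow> real^'mb \<Rightarrow> real^'d)
   \<Rightarrow> (real^'d \<Rightarrow> real) \<Rightarrow> (real^'ma) set \<Rightarrow> (real^'mb) set \<Rightarrow> real \<Rightarrow> real \<Rightarrow> real" where
  "const_Ch c f g A B T lam =
     exp (const_C1 c f A B T * T / lam) * (12 * (sup_norm UNIV g)\<^sup>2 + T * lam)"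

end

theory Submission
  imports Defs
begin

text \<open>
  Solved backwards in time, the explicit scheme reads \<open>u(t - \<tau>) = P u + \<tau> r\<close>: under the CFL condition
  \<open>P\<close> is a weighted average over neighbouring grid points, and \<open>r\<close> is the first-order term. The proof
  is an energy method for the pointwise square \<open>u\<^sup>2\<close>. Jensen's inequality for \<open>P\<close> has a gain
  (lemma \<open>scheme_avg_square\<close>): \<open>(P u)\<^sup>2 \<le> P (u\<^sup>2) - \<tau> \<mu> \<bar>\<nabla>u\<bar>\<^sup>2\<close>, where \<open>\<nabla>\<close> is the central difference
  gradient and \<open>\<mu>\<close> a lower bound of \<open>\<Sigma>\<^sub>i + \<nu>\<close>. Young's inequality with a rate \<open>K\<close> adds
  \<open>(\<tau> + 1/K) r\<^sup>2\<close> per unit of time and lets \<open>u\<^sup>2\<close> grow like \<open>e\<close> to the power \<open>K t\<close>. Summing along the random walk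
  with transitions \<open>P\<close> (the operator \<open>duhamel\<close>, written \<open>E\<close> here) gives, at every grid point
  (lemma \<open>energy_estimate\<close>), a bound of \<open>u\<^sup>2 + \<mu> E[\<bar>\<nabla>u\<bar>\<^sup>2]\<close>, up to the constant \<open>31/32\<close>, by
  the terminal data and \<open>(\<tau> + 1/K) E[r\<^sup>2]\<close>. As this is pointwise in \<open>(t, x)\<close>, it yields supremum bounds.

  For the error \<open>e\<^sub>n = V\<^sub>n - V\<close>, whose terminal value is \<open>0\<close>, optimality of the new policy at
  \<open>\<nabla>V\<^sub>n\<close> and the Lipschitz bound \<open>F = \<parallel>f\<parallel>\<close> of the Hamiltonian in \<open>p\<close> give the residual
  \<open>\<bar>r\<bar> \<le> F (\<bar>\<nabla>e\<^bsub>n+1\<^esub>\<bar> + 2 \<bar>\<nabla>e\<^sub>n\<bar>)\<close> (lemma \<open>policy_residual_le\<close>). With \<open>K = C\<^sub>1 / \<lambda>\<close> the factor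
  \<open>(\<tau> + 1/K) F\<^sup>2\<close> is at most \<open>\<mu> / 64\<close>, so the part with \<open>e\<^bsub>n+1\<^esub>\<close> is absorbed and
  \<open>E[\<bar>\<nabla>e\<^bsub>n+1\<^esub>\<bar>\<^sup>2] \<le> E[\<bar>\<nabla>e\<^sub>n\<bar>\<^sup>2] / 2\<close>. Pointwise, \<open>e\<^bsub>n+1\<^esub>\<^sup>2\<close> is controlled by the energy of
  \<open>e\<^sub>n\<close>, hence halves as well. The iteration starts from the same energy estimate for \<open>V\<close> and \<open>V\<^sub>0\<close>
  separately, where \<open>\<bar>r\<bar> \<le> \<parallel>c\<parallel> + F \<bar>\<nabla>u\<bar>\<close>; this is where \<open>\<parallel>g\<parallel>\<close> and \<open>T \<lambda>\<close> enter the constant.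
\<close>

section \<open>The averaging operator of the explicit scheme\<close>

definition grad_slice :: "real \<Rightarrow> (real^'d \<Rightarrow> real) \<Rightarrow> real^'d \<Rightarrow> real^'d" where
  "grad_slice h u x = grad_h h (\<lambda>_. u) 0 x"

definition scheme_avg ::
  "real \<Rightarrow> real \<Rightarrow> ('d::finite \<Rightarrow> real) \<Rightarrow> (real^'d \<Rightarrow> real) \<Rightarrow> real^'d \<Rightarrow> real" where
  "scheme_avg h \<tau> w u x = u x + \<tau> / 2 * (\<Sum>i\<in>UNIV. w i * lap_h h i (\<lambda>_. u) 0 x)"

lemma grad_h_eq_grad_slice: "grad_h h \<phi> t x = grad_slice h (\<phi> t) x"
  by (simp add: grad_slice_def grad_h_def)

lemma grad_slice_diff: "grad_slice h (\<lambda>y. u y - v y) x = grad_slice h u x - grad_slice h v x"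
  by (simp add: grad_slice_def grad_h_def vec_eq_iff diff_divide_distrib add_divide_distrib)

lemma scheme_avg_lincomb:
  "scheme_avg h \<tau> w (\<lambda>y. a * u y + b * v y) x = a * scheme_avg h \<tau> w u x + b * scheme_avg h \<tau> w v x"
proof -
  have "lap_h h i (\<lambda>_ y. a * u y + b * v y) 0 x
      = a * lap_h h i (\<lambda>_. u) 0 x + b * lap_h h i (\<lambda>_. v) 0 x" for i
    by (simp add: lap_h_def add_divide_distrib diff_divide_distrib algebra_simps)
  then show ?thesis
    by (simp add: scheme_avg_def sum.distrib sum_distrib_left algebra_simps)
qed

lemma scheme_avg_const: "scheme_avg h \<tau> w (\<lambda>_. C) x = C"
  by (simp add: scheme_avg_def lap_h_def)

lemma space_grid_shift:
  assumes "x \<in> space_grid h"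
  shows "x + h *\<^sub>R axis i 1 \<in> space_grid h" "x - h *\<^sub>R axis i 1 \<in> space_grid h"
proof -
  have "\<exists>k'::int. x $ j + h * axis i 1 $ j = h * of_int k'"
       "\<exists>k'::int. x $ j - h * axis i 1 $ j = h * of_int k'" for j
  proof -
    obtain k :: int where k: "x $ j = h * of_int k"
      using assms by (auto simp: space_grid_def)
    have "x $ j + h * axis i 1 $ j = h * of_int (k + (if j = i then 1 else 0))"
      using k by (simp add: axis_def algebra_simps)
    then show "\<exists>k'::int. x $ j + h * axis i 1 $ j = h * of_int k'" by blast
    have "x $ j - h * axis i 1 $ j = h * of_int (k - (if j = i then 1 else 0))"
      using k by (simp add: axis_def algebra_simps)
    then show "\<exists>k'::int. x $ j - h * axis i 1 $ j = h * of_int k'" by blast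
  qed
  then show "x + h *\<^sub>R axis i 1 \<in> space_grid h" "x - h *\<^sub>R axis i 1 \<in> space_grid h"
    by (simp_all add: space_grid_def)
qed

text \<open>The CFL condition says exactly that the weight of the centre \<open>x\<close> of the stencil is
  nonnegative, so the average is a convex combination of stencil values.\<close>

lemma scheme_avg_mono:
  fixes w :: "'d::finite \<Rightarrow> real"
  assumes h: "0 < h" and \<tau>: "0 < \<tau>" and w: "\<And>i. 0 \<le> w i"
    and cfl: "\<tau> * (\<Sum>i\<in>UNIV. w i) \<le> h\<^sup>2"
    and x: "x \<in> space_grid h" and le: "\<And>y. y \<in> space_grid h \<Longrightarrow> u y \<le> v y"
  shows "scheme_avg h \<tau> w u x \<le> scheme_avg h \<tau> w v x"
proof -
  let ?p = "\<lambda>i. x + h *\<^sub>R axis i 1" and ?m = "\<lambda>i. x - h *\<^sub>R axis i 1"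
  have split: "scheme_avg h \<tau> w q x
      = (1 - \<tau> * (\<Sum>i\<in>UNIV. w i) / h\<^sup>2) * q x
        + \<tau> / (2 * h\<^sup>2) * (\<Sum>i\<in>UNIV. w i * (q (?p i) + q (?m i)))" for q
  proof -
    have "(\<Sum>i\<in>UNIV. w i * lap_h h i (\<lambda>_. q) 0 x)
        = (\<Sum>i\<in>UNIV. w i * (q (?p i) + q (?m i)) / h\<^sup>2 - w i * (2 * q x / h\<^sup>2))"
      by (rule sum.cong) (simp_all add: lap_h_def diff_divide_distrib add_divide_distrib algebra_simps)
    also have "\<dots> = (\<Sum>i\<in>UNIV. w i * (q (?p i) + q (?m i))) / h\<^sup>2 - (\<Sum>i\<in>UNIV. w i) * (2 * q x / h\<^sup>2)"
      by (simp only: sum_subtractf sum_divide_distrib sum_distrib_right)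
    finally have lap: "(\<Sum>i\<in>UNIV. w i * lap_h h i (\<lambda>_. q) 0 x) = \<dots>" .
    show ?thesis
      unfolding scheme_avg_def lap using h by (simp add: field_simps)
  qed
  have "0 \<le> 1 - \<tau> * (\<Sum>i\<in>UNIV. w i) / h\<^sup>2"
    using cfl h by (simp add: divide_simps)
  then have "(1 - \<tau> * (\<Sum>i\<in>UNIV. w i) / h\<^sup>2) * u x \<le> (1 - \<tau> * (\<Sum>i\<in>UNIV. w i) / h\<^sup>2) * v x"
    using le[OF x] by (rule mult_left_mono[rotated])
  moreover have "(\<Sum>i\<in>UNIV. w i * (u (?p i) + u (?m i))) \<le> (\<Sum>i\<in>UNIV. w i * (v (?p i) + v (?m i)))"
    by (intro sum_mono mult_left_mono add_mono le space_grid_shift x w)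
  then have "\<tau> / (2 * h\<^sup>2) * (\<Sum>i\<in>UNIV. w i * (u (?p i) + u (?m i)))
      \<le> \<tau> / (2 * h\<^sup>2) * (\<Sum>i\<in>UNIV. w i * (v (?p i) + v (?m i)))"
    using \<tau> by (intro mult_left_mono) auto
  ultimately show ?thesis unfolding split by (rule add_mono)
qed

lemma Cauchy_Schwarz_weighted_sum:
  fixes w d :: "'i \<Rightarrow> real"
  assumes "\<And>i. i \<in> I \<Longrightarrow> 0 \<le> w i"
  shows "(\<Sum>i\<in>I. w i * d i)\<^sup>2 \<le> (\<Sum>i\<in>I. w i) * (\<Sum>i\<in>I. w i * (d i)\<^sup>2)"
proof -
  have "(\<Sum>i\<in>I. w i * d i) = (\<Sum>i\<in>I. sqrt (w i) * (sqrt (w i) * d i))"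
    using assms by (intro sum.cong) (simp_all flip: mult.assoc)
  also have "(\<dots>)\<^sup>2 \<le> (\<Sum>i\<in>I. (sqrt (w i))\<^sup>2) * (\<Sum>i\<in>I. (sqrt (w i) * d i)\<^sup>2)"
    by (rule Cauchy_Schwarz_ineq_sum)
  also have "\<dots> = (\<Sum>i\<in>I. w i) * (\<Sum>i\<in>I. w i * (d i)\<^sup>2)"
    using assms by (simp add: power_mult_distrib)
  finally show ?thesis .
qed

text \<open>Jensen's inequality for the average, with the gain that drives the whole proof. Splitting the
  one-sided differences into their symmetric and antisymmetric parts, the second difference of
  \<open>u\<^sup>2\<close> contains the square of the central difference and that of the second difference of \<open>u\<close>.
  The latter absorbs the square of the time increment, by Cauchy--Schwarz and the CFL condition;
  the former remains in full.\<close>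

lemma scheme_avg_square:
  fixes w :: "'d::finite \<Rightarrow> real"
  assumes h: "0 < h" and \<tau>: "0 < \<tau>" and \<mu>: "0 \<le> \<mu>" "\<And>i. \<mu> \<le> w i"
    and cfl: "\<tau> * (\<Sum>i\<in>UNIV. w i) \<le> h\<^sup>2"
  shows "(scheme_avg h \<tau> w u x)\<^sup>2
    \<le> scheme_avg h \<tau> w (\<lambda>y. (u y)\<^sup>2) x - \<tau> * \<mu> * (norm (grad_slice h u x))\<^sup>2"
proof -
  define \<delta> where "\<delta> i = lap_h h i (\<lambda>_. u) 0 x" for i
  define \<gamma> where "\<gamma> i = grad_slice h u x $ i" for i
  define S where "S = (\<Sum>i\<in>UNIV. w i * \<delta> i)"
  have w0: "0 \<le> w i" for i using \<mu>(1) \<mu>(2)[of i] by linarith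
  have lap2: "lap_h h i (\<lambda>_ y. (u y)\<^sup>2) 0 x = 2 * u x * \<delta> i + (2 * (\<gamma> i)\<^sup>2 + h\<^sup>2 / 2 * (\<delta> i)\<^sup>2)" for i
    unfolding \<delta>_def \<gamma>_def grad_slice_def grad_h_def lap_h_def using h
    by (simp add: field_simps power2_eq_square)
  have "(\<Sum>i\<in>UNIV. w i * lap_h h i (\<lambda>_ y. (u y)\<^sup>2) 0 x)
      = (\<Sum>i\<in>UNIV. 2 * u x * (w i * \<delta> i) + (2 * (w i * (\<gamma> i)\<^sup>2) + h\<^sup>2 / 2 * (w i * (\<delta> i)\<^sup>2)))"
    by (rule sum.cong) (simp_all add: lap2 algebra_simps)
  also have "\<dots> = 2 * u x * S + (2 * (\<Sum>i\<in>UNIV. w i * (\<gamma> i)\<^sup>2) + h\<^sup>2 / 2 * (\<Sum>i\<in>UNIV. w i * (\<delta> i)\<^sup>2))"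
    by (simp only: sum.distrib sum_distrib_left S_def)
  finally have avg2: "scheme_avg h \<tau> w (\<lambda>y. (u y)\<^sup>2) x = (u x)\<^sup>2 + \<tau> * u x * S
      + \<tau> * (\<Sum>i\<in>UNIV. w i * (\<gamma> i)\<^sup>2) + \<tau> / 4 * (h\<^sup>2 * (\<Sum>i\<in>UNIV. w i * (\<delta> i)\<^sup>2))"
    by (simp add: scheme_avg_def algebra_simps)
  have "\<tau> * S\<^sup>2 \<le> \<tau> * ((\<Sum>i\<in>UNIV. w i) * (\<Sum>i\<in>UNIV. w i * (\<delta> i)\<^sup>2))"
    unfolding S_def using \<tau> w0 by (intro mult_left_mono Cauchy_Schwarz_weighted_sum) auto
  also have "\<dots> \<le> h\<^sup>2 * (\<Sum>i\<in>UNIV. w i * (\<delta> i)\<^sup>2)"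
    unfolding mult.assoc[symmetric] using cfl w0 by (intro mult_right_mono sum_nonneg) auto
  finally have "\<tau> / 4 * (\<tau> * S\<^sup>2) \<le> \<tau> / 4 * (h\<^sup>2 * (\<Sum>i\<in>UNIV. w i * (\<delta> i)\<^sup>2))"
    using \<tau> by (intro mult_left_mono) auto
  moreover have "\<mu> * (norm (grad_slice h u x))\<^sup>2 \<le> (\<Sum>i\<in>UNIV. w i * (\<gamma> i)\<^sup>2)"
  proof -
    have "(norm (grad_slice h u x))\<^sup>2 = (\<Sum>i\<in>UNIV. (\<gamma> i)\<^sup>2)"
      by (simp add: norm_vec_def L2_set_def sum_nonneg \<gamma>_def)
    then have "\<mu> * (norm (grad_slice h u x))\<^sup>2 = (\<Sum>i\<in>UNIV. \<mu> * (\<gamma> i)\<^sup>2)"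
      by (simp add: sum_distrib_left)
    then show ?thesis using \<mu>(2) by (simp add: sum_mono mult_right_mono)
  qed
  then have "\<tau> * (\<mu> * (norm (grad_slice h u x))\<^sup>2) \<le> \<tau> * (\<Sum>i\<in>UNIV. w i * (\<gamma> i)\<^sup>2)"
    using \<tau> by (intro mult_left_mono) auto
  moreover have "(scheme_avg h \<tau> w u x)\<^sup>2 = (u x)\<^sup>2 + \<tau> * u x * S + \<tau> / 4 * (\<tau> * S\<^sup>2)"
    by (simp add: scheme_avg_def S_def \<delta>_def power2_eq_square algebra_simps)
  ultimately show ?thesis unfolding avg2 by (simp only: mult.assoc)
qed

lemma square_add_le_Young:
  fixes y r K \<tau> :: real
  assumes "0 < K" "0 \<le> \<tau>"
  shows "(y + \<tau> * r)\<^sup>2 \<le> (1 + K * \<tau>) * y\<^sup>2 + \<tau> * (\<tau> + 1 / K) * r\<^sup>2"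
proof -
  have "(1 + K * \<tau>) * y\<^sup>2 + \<tau> * (\<tau> + 1 / K) * r\<^sup>2 - (y + \<tau> * r)\<^sup>2 = \<tau> / K * (K * y - r)\<^sup>2"
    using assms by (simp add: field_simps power2_eq_square)
  also have "\<dots> \<ge> 0" using assms by simp
  finally show ?thesis by simp
qed

section \<open>Weighted energy estimates\<close>

text \<open>Time is counted in steps from the terminal time, so that step \<open>k\<close> stands for
  \<open>t = T - k \<tau>\<close> and the scheme runs forwards in \<open>k\<close>. The number \<open>K\<close> is the exponential rate that
  is paid for Young's inequality.\<close>

locale explicit_scheme =
  fixes h \<tau> K \<mu> :: real and N :: nat and w :: "nat \<Rightarrow> real^'d::finite \<Rightarrow> 'd \<Rightarrow> real"
  assumes h_pos: "0 < h" and \<tau>_pos: "0 < \<tau>" and K_pos: "0 < K" and \<mu>_pos: "0 < \<mu>"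
    and w_lower: "\<And>k x i. k < N \<Longrightarrow> x \<in> space_grid h \<Longrightarrow> \<mu> \<le> w k x i"
    and w_cfl: "\<And>k x. k < N \<Longrightarrow> x \<in> space_grid h \<Longrightarrow> \<tau> * (\<Sum>i\<in>UNIV. w k x i) \<le> h\<^sup>2"
begin

abbreviation avg :: "nat \<Rightarrow> (real^'d \<Rightarrow> real) \<Rightarrow> real^'d \<Rightarrow> real" where
  "avg k u x \<equiv> scheme_avg h \<tau> (w k x) u x"

text \<open>The discrete Duhamel integral: in terms of the random walk whose transitions are the averages,
  the expected sum of a running cost \<open>f\<close> with weights growing at rate \<open>K\<close>.\<close>

primrec duhamel :: "(nat \<Rightarrow> real^'d \<Rightarrow> real) \<Rightarrow> nat \<Rightarrow> real^'d \<Rightarrow> real" where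
  "duhamel f 0 = (\<lambda>x. 0)"
| "duhamel f (Suc k) = (\<lambda>x. (1 + K * \<tau>) * avg k (duhamel f k) x + \<tau> * f k x)"

lemma avg_mono:
  assumes "k < N" "x \<in> space_grid h" "\<And>y. y \<in> space_grid h \<Longrightarrow> u y \<le> v y"
  shows "avg k u x \<le> avg k v x"
proof (rule scheme_avg_mono[OF h_pos \<tau>_pos _ w_cfl[OF assms(1,2)] assms(2,3)])
  show "0 \<le> w k x i" for i using w_lower[OF assms(1,2), of i] \<mu>_pos by linarith
qed

lemma duhamel_lincomb:
  "duhamel (\<lambda>k x. a * f k x + b * g k x) k x = a * duhamel f k x + b * duhamel g k x"
proof (induction k arbitrary: x)
  case (Suc k)
  then have "duhamel (\<lambda>k x. a * f k x + b * g k x) k = (\<lambda>x. a * duhamel f k x + b * duhamel g k x)"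
    by blast
  then show ?case by (simp add: scheme_avg_lincomb algebra_simps)
qed simp

lemma duhamel_const: "duhamel (\<lambda>_ _. 1) k x = ((1 + K * \<tau>) ^ k - 1) / K"
proof (induction k arbitrary: x)
  case (Suc k)
  then have "duhamel (\<lambda>_ _. 1) k = (\<lambda>x. ((1 + K * \<tau>) ^ k - 1) / K)" by blast
  then show ?case using K_pos by (simp add: scheme_avg_const field_simps)
qed simp

text \<open>The discrete maximum principle. The averages are monotone and reproduce constants, so an
  initial bound \<open>M\<close> only grows by the factor \<open>1 + K \<tau>\<close> per step.\<close>

lemma le_duhamel:
  assumes init: "\<And>x. x \<in> space_grid h \<Longrightarrow> u 0 x \<le> M"
    and step: "\<And>k x. k < N \<Longrightarrow> x \<in> space_grid h \<Longrightarrow>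
      u (Suc k) x \<le> (1 + K * \<tau>) * avg k (u k) x + \<tau> * f k x"
    and "k \<le> N" "x \<in> space_grid h"
  shows "u k x \<le> (1 + K * \<tau>) ^ k * M + duhamel f k x"
  using assms(3,4)
proof (induction k arbitrary: x)
  case 0
  then show ?case using init by simp
next
  case (Suc k)
  have K1: "0 \<le> 1 + K * \<tau>" using K_pos \<tau>_pos by (simp add: add_nonneg_nonneg)
  have "avg k (u k) x \<le> avg k (\<lambda>y. ((1 + K * \<tau>) ^ k * M) * 1 + 1 * duhamel f k y) x"
    using Suc by (intro avg_mono) auto
  also have "\<dots> = (1 + K * \<tau>) ^ k * M + avg k (duhamel f k) x"
    unfolding scheme_avg_lincomb by (simp add: scheme_avg_const)
  finally have "(1 + K * \<tau>) * avg k (u k) x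
      \<le> (1 + K * \<tau>) * ((1 + K * \<tau>) ^ k * M + avg k (duhamel f k) x)"
    using K1 by (rule mult_left_mono)
  then show ?case using step[of k x] Suc.prems by (simp add: algebra_simps)
qed

lemma duhamel_mono:
  assumes "\<And>k x. k < N \<Longrightarrow> x \<in> space_grid h \<Longrightarrow> f k x \<le> g k x"
    and "k \<le> N" "x \<in> space_grid h"
  shows "duhamel f k x \<le> duhamel g k x"
  using le_duhamel[of "duhamel f" 0 g k x] assms \<tau>_pos by (simp add: mult_left_mono)

lemma duhamel_nonneg:
  assumes "\<And>k x. 0 \<le> f k x" "k \<le> N" "x \<in> space_grid h"
  shows "0 \<le> duhamel f k x"
proof -
  have "duhamel (\<lambda>k x. 0 * f k x + 0 * f k x) k x \<le> duhamel f k x"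
    using assms by (intro duhamel_mono) auto
  then show ?thesis unfolding duhamel_lincomb by simp
qed

abbreviation grad_sq :: "(nat \<Rightarrow> real^'d \<Rightarrow> real) \<Rightarrow> nat \<Rightarrow> real^'d \<Rightarrow> real" where
  "grad_sq u k x \<equiv> (norm (grad_slice h (u k) x))\<^sup>2"

text \<open>The basic a priori bound. A right-hand side \<open>r\<close> may contain the gradient of the solution
  itself, as long as its coefficient \<open>p\<close> is small against the dissipation: it then uses up only
  \<open>1/32\<close> of the gain in Jensen's inequality, and \<open>31/32\<close> are left on the left-hand side.\<close>

lemma energy_estimate:
  assumes init: "\<And>x. x \<in> space_grid h \<Longrightarrow> (u 0 x)\<^sup>2 \<le> M"
    and eqn: "\<And>k x. k < N \<Longrightarrow> x \<in> space_grid h \<Longrightarrow> u (Suc k) x = avg k (u k) x + \<tau> * r k x"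
    and r: "\<And>k x. k < N \<Longrightarrow> x \<in> space_grid h \<Longrightarrow> (r k x)\<^sup>2 \<le> p * grad_sq u k x + f k x"
    and p: "(\<tau> + 1 / K) * p \<le> \<mu> / 32"
    and k: "k \<le> N" "x \<in> space_grid h"
  shows "(u k x)\<^sup>2 + 31 / 32 * \<mu> * duhamel (grad_sq u) k x
    \<le> (1 + K * \<tau>) ^ k * M + (\<tau> + 1 / K) * duhamel f k x"
proof -
  let ?\<theta> = "\<tau> + 1 / K"
  have \<theta>: "0 \<le> ?\<theta>" using K_pos \<tau>_pos by simp
  have "(u (Suc k) x)\<^sup>2 \<le> (1 + K * \<tau>) * avg k (\<lambda>y. (u k y)\<^sup>2) x
      + \<tau> * ((- (31 / 32 * \<mu>)) * grad_sq u k x + ?\<theta> * f k x)"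
    if kx: "k < N" "x \<in> space_grid h" for k x
  proof -
    let ?G = "grad_sq u k x"
    have sq: "(avg k (u k) x)\<^sup>2 \<le> avg k (\<lambda>y. (u k y)\<^sup>2) x - \<tau> * \<mu> * ?G"
      using \<mu>_pos w_lower[OF kx] w_cfl[OF kx] by (intro scheme_avg_square h_pos \<tau>_pos) auto
    have "(u (Suc k) x)\<^sup>2 \<le> (1 + K * \<tau>) * (avg k (u k) x)\<^sup>2 + \<tau> * ?\<theta> * (r k x)\<^sup>2"
      unfolding eqn[OF kx] using K_pos \<tau>_pos by (intro square_add_le_Young) auto
    moreover have "(1 + K * \<tau>) * (avg k (u k) x)\<^sup>2
        \<le> (1 + K * \<tau>) * (avg k (\<lambda>y. (u k y)\<^sup>2) x - \<tau> * \<mu> * ?G)"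
      using K_pos \<tau>_pos by (intro mult_left_mono sq) (simp add: add_nonneg_nonneg)
    moreover have "\<dots> \<le> (1 + K * \<tau>) * avg k (\<lambda>y. (u k y)\<^sup>2) x - \<tau> * (\<mu> * ?G)"
      using K_pos \<tau>_pos \<mu>_pos by (simp add: algebra_simps)
    moreover have "\<tau> * ?\<theta> * (r k x)\<^sup>2 \<le> \<tau> * (\<mu> / 32 * ?G + ?\<theta> * f k x)"
    proof -
      have "?\<theta> * (r k x)\<^sup>2 \<le> ?\<theta> * (p * ?G + f k x)" using r[OF kx] \<theta> by (rule mult_left_mono)
      also have "\<dots> = ?\<theta> * p * ?G + ?\<theta> * f k x" by (simp only: distrib_left mult.assoc)
      also have "\<dots> \<le> \<mu> / 32 * ?G + ?\<theta> * f k x"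
        using p by (intro add_right_mono mult_right_mono) auto
      finally have "?\<theta> * (r k x)\<^sup>2 \<le> \<mu> / 32 * ?G + ?\<theta> * f k x" .
      then have "\<tau> * (?\<theta> * (r k x)\<^sup>2) \<le> \<tau> * (\<mu> / 32 * ?G + ?\<theta> * f k x)"
        using \<tau>_pos by (intro mult_left_mono) auto
      then show ?thesis by (simp only: mult.assoc)
    qed
    moreover have "\<tau> * ((- (31 / 32 * \<mu>)) * ?G + ?\<theta> * f k x)
        = \<tau> * (\<mu> / 32 * ?G + ?\<theta> * f k x) - \<tau> * (\<mu> * ?G)"
      by (simp add: field_simps)
    ultimately show ?thesis by linarith
  qed
  from le_duhamel[of "\<lambda>k x. (u k x)\<^sup>2", OF init this k]
  show ?thesis unfolding duhamel_lincomb by (simp add: algebra_simps)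
qed

text \<open>Here \<open>e\<close> and \<open>e'\<close> are the errors before and after a policy update. By \<open>(a + 2 b)\<^sup>2 \<le> 2 a\<^sup>2 + 8 b\<^sup>2\<close>
  the residual splits into a part that the dissipation of \<open>e'\<close> absorbs and a source given by \<open>e\<close>.\<close>

lemma policy_error_step:
  assumes F: "(\<tau> + 1 / K) * (2 * F\<^sup>2) \<le> \<mu> / 32"
    and init: "\<And>x. x \<in> space_grid h \<Longrightarrow> e' 0 x = 0"
    and eqn: "\<And>k x. k < N \<Longrightarrow> x \<in> space_grid h \<Longrightarrow> e' (Suc k) x = avg k (e' k) x + \<tau> * r k x"
    and r: "\<And>k x. k < N \<Longrightarrow> x \<in> space_grid h \<Longrightarrow>
      \<bar>r k x\<bar> \<le> F * (norm (grad_slice h (e' k) x) + 2 * norm (grad_slice h (e k) x))"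
    and k: "k \<le> N" "x \<in> space_grid h"
  shows "(e' k x)\<^sup>2 + 31 / 32 * \<mu> * duhamel (grad_sq e') k x
    \<le> (\<tau> + 1 / K) * (8 * F\<^sup>2) * duhamel (grad_sq e) k x"
proof -
  have "(r k x)\<^sup>2 \<le> 2 * F\<^sup>2 * grad_sq e' k x + 8 * F\<^sup>2 * grad_sq e k x"
    if "k < N" "x \<in> space_grid h" for k x
  proof -
    let ?a = "norm (grad_slice h (e' k) x)" and ?b = "norm (grad_slice h (e k) x)"
    have "(r k x)\<^sup>2 \<le> (F * (?a + 2 * ?b))\<^sup>2"
      using power_mono[OF r[OF that], of 2] by simp
    moreover have "(F * (?a - 2 * ?b))\<^sup>2 \<ge> 0" by simp
    ultimately show ?thesis by (simp add: power2_eq_square algebra_simps)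
  qed
  from energy_estimate[of e' 0 r "2 * F\<^sup>2" "\<lambda>k x. 8 * F\<^sup>2 * grad_sq e k x", OF _ eqn this F k]
  have "(e' k x)\<^sup>2 + 31 / 32 * \<mu> * duhamel (grad_sq e') k x
    \<le> (\<tau> + 1 / K) * duhamel (\<lambda>k x. (8 * F\<^sup>2) * grad_sq e k x + 0 * grad_sq e k x) k x"
    using init by simp
  then show ?thesis unfolding duhamel_lincomb by simp
qed

lemma solution_gradient_bound:
  assumes F: "(\<tau> + 1 / K) * (2 * F\<^sup>2) \<le> \<mu> / 32"
    and init: "\<And>x. x \<in> space_grid h \<Longrightarrow> \<bar>v 0 x\<bar> \<le> G"
    and eqn: "\<And>k x. k < N \<Longrightarrow> x \<in> space_grid h \<Longrightarrow> v (Suc k) x = avg k (v k) x + \<tau> * r k x"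
    and r: "\<And>k x. k < N \<Longrightarrow> x \<in> space_grid h \<Longrightarrow>
      \<bar>r k x\<bar> \<le> C + F * norm (grad_slice h (v k) x)"
    and k: "k \<le> N" "x \<in> space_grid h"
  shows "31 / 32 * \<mu> * duhamel (grad_sq v) k x
    \<le> (1 + K * \<tau>) ^ k * G\<^sup>2 + (\<tau> + 1 / K) * (2 * C\<^sup>2) * (((1 + K * \<tau>) ^ k - 1) / K)"
proof -
  have r2: "(r k x)\<^sup>2 \<le> 2 * F\<^sup>2 * grad_sq v k x + 2 * C\<^sup>2 * 1"
    if "k < N" "x \<in> space_grid h" for k x
  proof -
    let ?a = "norm (grad_slice h (v k) x)"
    have "(r k x)\<^sup>2 \<le> (C + F * ?a)\<^sup>2"
      using power_mono[OF r[OF that], of 2] by simp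
    moreover have "(C - F * ?a)\<^sup>2 \<ge> 0" by simp
    ultimately show ?thesis by (simp add: power2_eq_square algebra_simps)
  qed
  have init2: "(v 0 x)\<^sup>2 \<le> G\<^sup>2" if "x \<in> space_grid h" for x
    using power_mono[OF init[OF that], of 2] by simp
  have const: "duhamel (\<lambda>k x. 2 * C\<^sup>2 * 1) k x = 2 * C\<^sup>2 * (((1 + K * \<tau>) ^ k - 1) / K)"
    using duhamel_lincomb[of "2 * C\<^sup>2" "\<lambda>_ _. 1" 0 "\<lambda>_ _. 1" k x] by (simp add: duhamel_const)
  from energy_estimate[of v "G\<^sup>2" r "2 * F\<^sup>2" "\<lambda>k x. 2 * C\<^sup>2 * 1", OF init2 eqn r2 F k]
  show ?thesis
    unfolding const mult.assoc[symmetric] using zero_le_power2[of "v k x"] by linarith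
qed

text \<open>One policy update multiplies the weighted gradient energy of the error by at most
  \<open>(1/8) / (31/32) \<le> 1/2\<close>: the right-hand side carries the factor \<open>\<mu> / 8\<close> and the dissipation
  \<open>31 \<mu> / 32\<close>. The pointwise error is then read off from the energy one iterate earlier.\<close>

lemma policy_error_bound:
  assumes F: "(\<tau> + 1 / K) * (2 * F\<^sup>2) \<le> \<mu> / 32"
    and step: "\<And>n. (e (Suc n) k x)\<^sup>2 + 31 / 32 * \<mu> * duhamel (grad_sq (e (Suc n))) k x
      \<le> (\<tau> + 1 / K) * (8 * F\<^sup>2) * duhamel (grad_sq (e n)) k x"
    and e0: "e 0 = (\<lambda>k x. v0 k x - v k x)"
    and v0: "31 / 32 * \<mu> * duhamel (grad_sq v0) k x \<le> M"
    and v: "31 / 32 * \<mu> * duhamel (grad_sq v) k x \<le> M"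
    and k: "k \<le> N" "x \<in> space_grid h"
  shows "(e (Suc n) k x)\<^sup>2 \<le> M / 2 ^ n"
proof -
  let ?E = "\<lambda>n. \<mu> * duhamel (grad_sq (e n)) k x"
  have E_nonneg: "0 \<le> duhamel (grad_sq u) k x" for u
    using k by (intro duhamel_nonneg) auto
  have step': "(e (Suc n) k x)\<^sup>2 + 31 / 32 * ?E (Suc n) \<le> ?E n / 8" for n
  proof -
    have "(\<tau> + 1 / K) * (8 * F\<^sup>2) * duhamel (grad_sq (e n)) k x
        \<le> \<mu> / 8 * duhamel (grad_sq (e n)) k x"
      using F by (intro mult_right_mono E_nonneg) (simp add: algebra_simps)
    with step[of n] show ?thesis by simp
  qed
  have E_pos: "0 \<le> ?E n" for n using E_nonneg[of "e n"] \<mu>_pos by simp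
  have E0: "31 / 32 * ?E 0 \<le> 4 * M"
  proof -
    have "duhamel (grad_sq (e 0)) k x \<le> duhamel (\<lambda>k x. 2 * grad_sq v0 k x + 2 * grad_sq v k x) k x"
    proof (intro duhamel_mono k)
      fix k x
      let ?a = "grad_slice h (v0 k) x" and ?b = "grad_slice h (v k) x"
      have "(norm (?a - ?b))\<^sup>2 \<le> (norm ?a + norm ?b)\<^sup>2"
        by (intro power_mono norm_triangle_ineq4) auto
      moreover have "(norm ?a - norm ?b)\<^sup>2 \<ge> 0" by simp
      ultimately show "grad_sq (e 0) k x \<le> 2 * grad_sq v0 k x + 2 * grad_sq v k x"
        unfolding e0 grad_slice_diff by (simp add: power2_eq_square algebra_simps)
    qed
    then have "\<mu> * duhamel (grad_sq (e 0)) k x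
        \<le> \<mu> * (2 * duhamel (grad_sq v0) k x + 2 * duhamel (grad_sq v) k x)"
      unfolding duhamel_lincomb using \<mu>_pos by (intro mult_left_mono) auto
    then show ?thesis using v0 v by (simp add: algebra_simps)
  qed
  have "?E n \<le> ?E 0 / 2 ^ n"
  proof (induction n)
    case (Suc n)
    have "?E (Suc n) \<le> ?E n / 2"
      using step'[of n] E_pos[of n] zero_le_power2[of "e (Suc n) k x"] by linarith
    with Suc show ?case by simp
  qed simp
  then have "(e (Suc n) k x)\<^sup>2 \<le> (?E 0 / 8) / 2 ^ n"
    using step'[of n] E_pos[of "Suc n"] by simp
  also have "\<dots> \<le> M / 2 ^ n"
    using E0 E_pos[of 0] by (intro divide_right_mono) (linarith, simp)
  finally show ?thesis .
qed

text \<open>The two parts of the Young factor \<open>\<tau> + 1 / K\<close> are treated differently: \<open>1 / K\<close> meets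
  \<open>(e\<^sup>y - 1) / y \<le> e\<^sup>y\<close>, whereas for \<open>\<tau>\<close> the estimate \<open>\<tau> \<le> T\<close> suffices.\<close>

lemma growth_bound:
  assumes k: "real k * \<tau> \<le> T" "\<tau> \<le> T" and lam: "0 \<le> lam" "2 * C\<^sup>2 \<le> K * lam / 24"
  shows "(1 + K * \<tau>) ^ k * G\<^sup>2 + (\<tau> + 1 / K) * (2 * C\<^sup>2) * (((1 + K * \<tau>) ^ k - 1) / K)
    \<le> exp (K * T) * (G\<^sup>2 + T * lam / 12)"
proof -
  let ?P = "(1 + K * \<tau>) ^ k" and ?E = "exp (K * T)"
  have "?P \<le> exp (K * \<tau>) ^ k"
    using K_pos \<tau>_pos by (intro power_mono exp_ge_add_one_self) (simp add: add_nonneg_nonneg)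
  also have "\<dots> = exp (K * (real k * \<tau>))"
    by (simp add: exp_of_nat_mult[symmetric] algebra_simps)
  also have "\<dots> \<le> ?E" using k K_pos by simp
  finally have PE: "?P \<le> ?E" .
  have P1: "1 \<le> ?P" using K_pos \<tau>_pos by (intro one_le_power) simp
  have "1 - K * T \<le> exp (- (K * T))" using exp_ge_add_one_self[of "- (K * T)"] by simp
  then have "(1 - K * T) * ?E \<le> exp (- (K * T)) * ?E" by (intro mult_right_mono) auto
  also have "\<dots> = 1" by (simp add: exp_minus)
  finally have "?E - 1 \<le> K * (T * ?E)" by (simp add: algebra_simps)
  then have "?P - 1 \<le> K * (T * ?E)" using PE by linarith
  then have growth: "(?P - 1) / K \<le> T * ?E" using K_pos by (simp add: divide_le_eq mult.commute)
  have "\<tau> * (?P - 1) \<le> T * ?E"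
    using k \<tau>_pos P1 PE by (intro mult_mono) auto
  with growth have two: "\<tau> * (?P - 1) + (?P - 1) / K \<le> 2 * (T * ?E)" by linarith
  have "(\<tau> + 1 / K) * (2 * C\<^sup>2) * ((?P - 1) / K)
      = (2 * C\<^sup>2 / K) * (\<tau> * (?P - 1) + (?P - 1) / K)"
    using K_pos by (simp add: field_simps)
  also have "\<dots> \<le> lam / 24 * (2 * (T * ?E))"
  proof (intro mult_mono two)
    show "2 * C\<^sup>2 / K \<le> lam / 24" using lam K_pos by (simp add: field_simps)
    show "0 \<le> lam / 24" using lam by simp
    show "0 \<le> \<tau> * (?P - 1) + (?P - 1) / K" using K_pos \<tau>_pos P1 by simp
  qed
  finally have "(\<tau> + 1 / K) * (2 * C\<^sup>2) * ((?P - 1) / K) \<le> lam / 24 * (2 * (T * ?E))" .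
  moreover have "?P * G\<^sup>2 \<le> ?E * G\<^sup>2" using PE by (intro mult_right_mono) auto
  moreover have "?E * (G\<^sup>2 + T * lam / 12) = ?E * G\<^sup>2 + lam / 24 * (2 * (T * ?E))"
    by (simp add: algebra_simps)
  ultimately show ?thesis by linarith
qed

end

section \<open>Bounds for the Hamiltonian\<close>

lemma sup_inf_le_sup_inf_add:
  fixes \<phi> \<psi> :: "'a \<Rightarrow> 'b \<Rightarrow> real"
  assumes "A \<noteq> {}" "B \<noteq> {}"
    and bnd: "\<And>a b. a \<in> A \<Longrightarrow> b \<in> B \<Longrightarrow> \<bar>\<phi> a b\<bar> \<le> M" "\<And>a b. a \<in> A \<Longrightarrow> b \<in> B \<Longrightarrow> \<bar>\<psi> a b\<bar> \<le> M"
    and le: "\<And>a b. a \<in> A \<Longrightarrow> b \<in> B \<Longrightarrow> \<phi> a b \<le> \<psi> a b + \<delta>"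
  shows "(SUP b\<in>B. INF a\<in>A. \<phi> a b) \<le> (SUP b\<in>B. INF a\<in>A. \<psi> a b) + \<delta>"
proof -
  have low: "bdd_below ((\<lambda>a. \<phi> a b) ` A)" "bdd_below ((\<lambda>a. \<psi> a b) ` A)" if "b \<in> B" for b
    using bnd that by (auto intro!: bdd_belowI[of _ "-M"] simp: abs_le_iff) (smt (verit))+
  obtain a0 where a0: "a0 \<in> A" using assms(1) by blast
  have up: "bdd_above ((\<lambda>b. INF a\<in>A. \<psi> a b) ` B)"
  proof (intro bdd_aboveI[of _ M])
    fix y assume "y \<in> (\<lambda>b. INF a\<in>A. \<psi> a b) ` B"
    then obtain b where b: "b \<in> B" "y = (INF a\<in>A. \<psi> a b)" by blast
    have "(INF a\<in>A. \<psi> a b) \<le> \<psi> a0 b" using low(2)[OF b(1)] a0 by (rule cINF_lower)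
    also have "\<dots> \<le> M" using bnd(2)[OF a0 b(1)] by simp
    finally show "y \<le> M" using b by simp
  qed
  show ?thesis
  proof (rule cSUP_least[OF assms(2)])
    fix b assume b: "b \<in> B"
    have "(INF a\<in>A. \<phi> a b) - \<delta> \<le> (INF a\<in>A. \<psi> a b)"
    proof (rule cINF_greatest[OF assms(1)])
      fix a assume a: "a \<in> A"
      have "(INF a\<in>A. \<phi> a b) \<le> \<phi> a b" using low(1)[OF b] a by (rule cINF_lower)
      then show "(INF a\<in>A. \<phi> a b) - \<delta> \<le> \<psi> a b" using le[OF a b] by linarith
    qed
    also have "\<dots> \<le> (SUP b\<in>B. INF a\<in>A. \<psi> a b)" using b up by (rule cSUP_upper)
    finally show "(INF a\<in>A. \<phi> a b) \<le> (SUP b\<in>B. INF a\<in>A. \<psi> a b) + \<delta>" by simp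
  qed
qed

lemma abs_sup_inf_diff_le:
  fixes \<phi> \<psi> :: "'a \<Rightarrow> 'b \<Rightarrow> real"
  assumes "A \<noteq> {}" "B \<noteq> {}"
    and "\<And>a b. a \<in> A \<Longrightarrow> b \<in> B \<Longrightarrow> \<bar>\<phi> a b\<bar> \<le> M"
    and "\<And>a b. a \<in> A \<Longrightarrow> b \<in> B \<Longrightarrow> \<bar>\<psi> a b\<bar> \<le> M"
    and "\<And>a b. a \<in> A \<Longrightarrow> b \<in> B \<Longrightarrow> \<bar>\<phi> a b - \<psi> a b\<bar> \<le> \<delta>"
  shows "\<bar>(SUP b\<in>B. INF a\<in>A. \<phi> a b) - (SUP b\<in>B. INF a\<in>A. \<psi> a b)\<bar> \<le> \<delta>"
proof -
  have "\<phi> a b \<le> \<psi> a b + \<delta>" "\<psi> a b \<le> \<phi> a b + \<delta>" if "a \<in> A" "b \<in> B" for a b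
    using assms(5)[OF that] by linarith+
  then have "(SUP b\<in>B. INF a\<in>A. \<phi> a b) \<le> (SUP b\<in>B. INF a\<in>A. \<psi> a b) + \<delta>"
    and "(SUP b\<in>B. INF a\<in>A. \<psi> a b) \<le> (SUP b\<in>B. INF a\<in>A. \<phi> a b) + \<delta>"
    by (intro sup_inf_le_sup_inf_add[where M = M] assms(1-4); blast)+
  then show ?thesis by linarith
qed

lemma abs_lagrangian_le:
  assumes "\<bar>c t x a b\<bar> \<le> C" "norm (f t x a b) \<le> F"
  shows "\<bar>lagrangian c f t x p a b\<bar> \<le> C + F * norm p"
proof -
  have "\<bar>p \<bullet> f t x a b\<bar> \<le> norm p * norm (f t x a b)" by (rule Cauchy_Schwarz_ineq2)
  also have "\<dots> \<le> norm p * F" using assms by (intro mult_left_mono) auto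
  finally show ?thesis using assms by (simp add: lagrangian_def mult.commute)
qed

lemma abs_lagrangian_diff_le:
  assumes "norm (f t x a b) \<le> F"
  shows "\<bar>lagrangian c f t x p a b - lagrangian c f t x q a b\<bar> \<le> F * norm (p - q)"
  using abs_lagrangian_le[of "\<lambda>_ _ _ _. 0" t x a b 0 f F "p - q"] assms
  by (simp add: lagrangian_def inner_diff_left)

context
  fixes c :: "real \<Rightarrow> real^'d \<Rightarrow> real^'ma \<Rightarrow> real^'mb \<Rightarrow> real"
    and f :: "real \<Rightarrow> real^'d \<Rightarrow> real^'ma \<Rightarrow> real^'mb \<Rightarrow> real^'d"
    and A B t x C F
  assumes ne: "A \<noteq> {}" "B \<noteq> {}"
    and c: "\<And>a b. a \<in> A \<Longrightarrow> b \<in> B \<Longrightarrow> \<bar>c t x a b\<bar> \<le> C"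
    and f: "\<And>a b. a \<in> A \<Longrightarrow> b \<in> B \<Longrightarrow> norm (f t x a b) \<le> F"
begin

lemma abs_hamiltonian_le: "\<bar>hamiltonian c f A B t x p\<bar> \<le> C + F * norm p"
proof -
  have L: "\<bar>lagrangian c f t x p a b\<bar> \<le> C + F * norm p" if "a \<in> A" "b \<in> B" for a b
    by (rule abs_lagrangian_le[of c t x a b C f F p, OF c[OF that] f[OF that]])
  then have "0 \<le> C + F * norm p"
    using ne by (meson abs_ge_zero ex_in_conv order_trans)
  with L have "\<bar>(SUP b\<in>B. INF a\<in>A. lagrangian c f t x p a b) - (SUP b\<in>B. INF a\<in>A. 0)\<bar> \<le> C + F * norm p"
    by (intro abs_sup_inf_diff_le[OF ne]) auto
  then show ?thesis using ne by (simp add: hamiltonian_def)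
qed

lemma abs_hamiltonian_diff_le:
  "\<bar>hamiltonian c f A B t x p - hamiltonian c f A B t x q\<bar> \<le> F * norm (p - q)"
  unfolding hamiltonian_def
proof (rule abs_sup_inf_diff_le[OF ne])
  fix a b assume "a \<in> A" "b \<in> B"
  note cb = c[OF this] and fb = f[OF this]
  have "F \<ge> 0" using fb norm_ge_zero[of "f t x a b"] by linarith
  show "\<bar>lagrangian c f t x p a b\<bar> \<le> C + F * max (norm p) (norm q)"
    using abs_lagrangian_le[of c t x a b C f F p, OF cb fb]
      mult_left_mono[of "norm p" "max (norm p) (norm q)" F] \<open>F \<ge> 0\<close> by simp
  show "\<bar>lagrangian c f t x q a b\<bar> \<le> C + F * max (norm p) (norm q)"
    using abs_lagrangian_le[of c t x a b C f F q, OF cb fb]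
      mult_left_mono[of "norm q" "max (norm p) (norm q)" F] \<open>F \<ge> 0\<close> by simp
  show "\<bar>lagrangian c f t x p a b - lagrangian c f t x q a b\<bar> \<le> F * norm (p - q)"
    by (rule abs_lagrangian_diff_le[of f t x a b F c p q, OF fb])
qed

text \<open>The residual of a new iterate with gradient \<open>p'\<close> against the exact equation with gradient \<open>r\<close>.
  The new policy is optimal at the old gradient \<open>q\<close>, so the Lagrangian is compared with the
  Hamiltonian there. That costs \<open>p' - q\<close> once and \<open>q - r\<close> once, and \<open>p' - q\<close> passes through \<open>r\<close>.\<close>

lemma policy_residual_le:
  assumes opt: "hamiltonian c f A B t x q = lagrangian c f t x q a b" and ab: "a \<in> A" "b \<in> B"
  shows "\<bar>lagrangian c f t x p' a b - hamiltonian c f A B t x r\<bar>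
    \<le> F * (norm (p' - r) + 2 * norm (q - r))"
proof -
  have "0 \<le> F" using f[OF ab] norm_ge_zero[of "f t x a b"] by linarith
  moreover have "norm (p' - q) \<le> norm (p' - r) + norm (q - r)"
    using norm_triangle_ineq4[of "p' - r" "q - r"] by simp
  ultimately have "F * norm (p' - q) \<le> F * (norm (p' - r) + norm (q - r))"
    by (intro mult_left_mono)
  moreover have "\<bar>lagrangian c f t x p' a b - lagrangian c f t x q a b\<bar> \<le> F * norm (p' - q)"
    by (rule abs_lagrangian_diff_le[of f t x a b F c p' q, OF f[OF ab]])
  ultimately show ?thesis
    using abs_hamiltonian_diff_le[of q r] opt by (simp add: algebra_simps)
qed

end

lemma hamiltonian_eq_lagrangian:
  assumes amin: "\<And>b. b \<in> B \<Longrightarrow> is_arg_min (\<lambda>a. lagrangian c f t x p a b) (\<lambda>a. a \<in> A) (\<alpha> b)"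
    and bmax: "is_arg_max (\<lambda>b. lagrangian c f t x p (\<alpha> b) b) (\<lambda>b. b \<in> B) \<beta>"
  shows "hamiltonian c f A B t x p = lagrangian c f t x p (\<alpha> \<beta>) \<beta>"
proof -
  have "(INF a\<in>A. lagrangian c f t x p a b) = lagrangian c f t x p (\<alpha> b) b" if "b \<in> B" for b
    using amin[OF that] by (intro cInf_eq_minimum) (auto simp: is_arg_min_def not_less)
  then have "hamiltonian c f A B t x p = (SUP b\<in>B. lagrangian c f t x p (\<alpha> b) b)"
    unfolding hamiltonian_def by (intro SUP_cong) auto
  also have "\<dots> = lagrangian c f t x p (\<alpha> \<beta>) \<beta>"
    using bmax by (intro cSup_eq_maximum) (auto simp: is_arg_max_def not_less)
  finally show ?thesis .
qed

section \<open>The policy iteration scheme\<close>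

lemma solves_scheme_step:
  assumes "solves_scheme \<sigma> g T \<tau> h \<nu> F V" "0 < \<tau>"
    and "t \<in> time_grid \<tau> T - {0}" "x \<in> space_grid h"
  shows "V (t - \<tau>) x = scheme_avg h \<tau> (\<lambda>i. diffusion \<sigma> i t x + \<nu>) (V t) x
    + \<tau> * F t x (grad_slice h (V t) x)"
proof -
  have lap: "lap_h h i V t x = lap_h h i (\<lambda>_. V t) 0 x" for i by (simp add: lap_h_def)
  have "time_diff \<tau> V t x + F t x (grad_h h V t x)
      = - (1/2) * (\<Sum>i\<in>UNIV. (diffusion \<sigma> i t x + \<nu>) * lap_h h i V t x)"
    using assms by (simp add: solves_scheme_def)
  then have eq: "time_diff \<tau> V t x + F t x (grad_slice h (V t) x)
      = - (1/2) * (\<Sum>i\<in>UNIV. (diffusion \<sigma> i t x + \<nu>) * lap_h h i (\<lambda>_. V t) 0 x)"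
    by (simp add: lap grad_h_eq_grad_slice)
  have "V (t - \<tau>) x = V t x - \<tau> * time_diff \<tau> V t x"
    using assms(2) by (simp add: time_diff_def)
  also have "time_diff \<tau> V t x = - F t x (grad_slice h (V t) x)
      - (1/2) * (\<Sum>i\<in>UNIV. (diffusion \<sigma> i t x + \<nu>) * lap_h h i (\<lambda>_. V t) 0 x)"
    using eq by linarith
  finally show ?thesis by (simp add: scheme_avg_def algebra_simps)
qed

lemma norm_le_sup_norm:
  assumes "bounded (F ` S)" "z \<in> S"
  shows "norm (F z) \<le> sup_norm S F"
proof -
  obtain M where "\<And>z. z \<in> S \<Longrightarrow> norm (F z) \<le> M"
    using assms(1) by (auto simp: bounded_iff)
  then have "bdd_above ((\<lambda>z. norm (F z)) ` S)" by (intro bdd_aboveI2)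
  then show ?thesis unfolding sup_norm_def using assms(2) by (rule cSUP_upper[rotated])
qed

theorem theorem1p1:
  fixes T h \<tau> \<nu> lam Lam :: real
    and A :: "(real^'ma) set"
    and B :: "(real^'mb) set"
    and c :: "real \<Rightarrow> real^'d \<Rightarrow> real^'ma \<Rightarrow> real^'mb \<Rightarrow> real"
    and f :: "real \<Rightarrow> real^'d \<Rightarrow> real^'ma \<Rightarrow> real^'mb \<Rightarrow> real^'d"
    and g :: "real^'d \<Rightarrow> real"
    and \<sigma> :: "real \<Rightarrow> real^'d \<Rightarrow> real^'d^'d"
    and amin :: "real \<Rightarrow> real^'d \<Rightarrow> real^'d \<Rightarrow> real^'mb \<Rightarrow> real^'ma"
    and V :: "real \<Rightarrow> real^'d \<Rightarrow> real"
    and \<alpha>s :: "nat \<Rightarrow> real \<Rightarrow> real^'d \<Rightarrow> real^'mb \<Rightarrow> real^'ma"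
    and \<alpha> :: "nat \<Rightarrow> real \<Rightarrow> real^'d \<Rightarrow> real^'ma"
    and \<beta> :: "nat \<Rightarrow> real \<Rightarrow> real^'d \<Rightarrow> real^'mb"
    and Vn :: "nat \<Rightarrow> real \<Rightarrow> real^'d \<Rightarrow> real"
  assumes T_pos: "T > 0"
    and A_compact: "compact A"
    and B_compact: "compact B"
    and c_bounded: "bounded ((\<lambda>(t, x, a, b). c t x a b) ` ({0..T} \<times> UNIV \<times> A \<times> B))"
    and f_bounded: "bounded ((\<lambda>(t, x, a, b). f t x a b) ` ({0..T} \<times> UNIV \<times> A \<times> B))"
    and g_bounded: "bounded (range g)"
    and sigma_bounded: "bounded ((\<lambda>(t, x). \<sigma> t x) ` ({0..T} \<times> UNIV))"
    and sigma_diag: "\<forall>t\<in>{0..T}. \<forall>x i j. i \<noteq> j \<longrightarrow> \<sigma> t x $ i $ j = 0"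
    and selection: "\<forall>(t, x)\<in>st_grid \<tau> h T. \<forall>p.
           (\<forall>b\<in>B. is_arg_min (\<lambda>a. lagrangian c f t x p a b) (\<lambda>a. a \<in> A) (amin t x p b)) \<and>
           (\<exists>b. is_arg_max (\<lambda>b. lagrangian c f t x p (amin t x p b) b) (\<lambda>b. b \<in> B) b)"
    and h_range: "0 < h" "h < 1"
    and tau_range: "0 < \<tau>" "\<tau> < 1"
    and T_tau: "T / \<tau> \<in> \<nat>"
    and nu_nonneg: "\<nu> \<ge> 0"
    and nu_monotone: "\<forall>i. \<forall>t\<in>{0..T}. \<forall>x. \<forall>a\<in>A. \<forall>b\<in>B.
           \<nu> + diffusion \<sigma> i t x \<ge> h * \<bar>f t x a b $ i\<bar>"
    and cfl: "real CARD('d) * \<nu> + (SUP (t, x)\<in>st_grid \<tau> h T. \<Sum>i\<in>UNIV. diffusion \<sigma> i t x)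
           \<le> h\<^sup>2 / \<tau>"
    and step_sigma: "real CARD('d) * \<tau> *
           (MAX i. sup_norm ({0..T} \<times> UNIV) (\<lambda>(t, x). diffusion \<sigma> i t x)) \<le> 4 * h\<^sup>2"
    and step_data: "96 * \<tau> * data_bound c f A B T
           \<le> (MIN i. INF (t, x)\<in>{0..T} \<times> UNIV. diffusion \<sigma> i t x) + \<nu>"
    and lam_bounds: "Lam > lam" "lam \<ge> \<nu>" "0 < lam"
    and ellipticity: "\<forall>i. \<forall>t\<in>{0..T}. \<forall>x.
           lam \<le> diffusion \<sigma> i t x + \<nu> \<and> diffusion \<sigma> i t x + \<nu> \<le> Lam"
    and V_solves: "solves_scheme \<sigma> g T \<tau> h \<nu> (hamiltonian c f A B) V"
    and alpha0: "\<exists>K. K-lipschitz_on ({0..T} \<times> UNIV) (\<lambda>(t, x). \<alpha> 0 t x)"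
           "\<forall>t\<in>{0..T}. \<forall>x. \<alpha> 0 t x \<in> A"
    and beta0: "\<exists>K. K-lipschitz_on ({0..T} \<times> UNIV) (\<lambda>(t, x). \<beta> 0 t x)"
           "\<forall>t\<in>{0..T}. \<forall>x. \<beta> 0 t x \<in> B"
    and PI: "policy_iteration c f \<sigma> g A B T \<tau> h \<nu> \<alpha>s \<alpha> \<beta> Vn"
  shows "\<forall>n\<ge>1.
           bdd_above ((\<lambda>(t, x). \<bar>Vn n t x - V t x\<bar>\<^sup>2) ` st_grid \<tau> h T) \<and>
           (SUP (t, x)\<in>st_grid \<tau> h T. \<bar>Vn n t x - V t x\<bar>\<^sup>2)
             \<le> const_Ch c f g A B T lam / 2 ^ (n + 1)"
proof -
  obtain N where N: "T / \<tau> = real N" using T_tau by (auto elim: Nats_cases)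
  have NT: "T = real N * \<tau>" using N tau_range by (simp add: field_simps)
  have N1: "1 \<le> N" using NT T_pos by (cases N) auto
  have \<tau>T: "\<tau> \<le> T"
    unfolding NT using mult_right_mono[of 1 "real N" \<tau>] N1 tau_range by simp
  define s where "s k = T - real k * \<tau>" for k
  have s_Suc: "s (Suc k) = s k - \<tau>" for k by (simp add: s_def algebra_simps)
  have s_eq: "s k = real (N - k) * \<tau>" if "k \<le> N" for k
    using that by (simp add: s_def NT of_nat_diff algebra_simps)
  have s_grid: "s k \<in> time_grid \<tau> T" if "k \<le> N" for k
    unfolding s_eq[OF that] time_grid_def NT using tau_range by auto
  have s_pos: "s k \<in> time_grid \<tau> T - {0}" if "k < N" for k
    using s_grid[of k] s_eq[of k] that tau_range by auto
  have grid_s: "\<exists>k\<le>N. t = s k" if t: "t \<in> time_grid \<tau> T" for t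
  proof -
    obtain j where j: "t = real j * \<tau>" "real j * \<tau> \<le> T" using t by (auto simp: time_grid_def)
    then have "j \<le> N" using tau_range by (simp add: NT)
    then have "t = s (N - j)" using s_eq[of "N - j"] j by simp
    then show ?thesis using diff_le_self by blast
  qed
  have grid_T: "t \<in> {0..T}" if "t \<in> time_grid \<tau> T" for t
    using that tau_range by (auto simp: time_grid_def)
  have s_T: "s k \<in> {0..T}" if "k \<le> N" for k using grid_T s_grid that by blast

  have ne: "A \<noteq> {}" "B \<noteq> {}" using alpha0(2) beta0(2) T_pos by force+
  define C where "C = sup_norm ({0..T} \<times> UNIV \<times> A \<times> B) (\<lambda>(t, x, a, b). c t x a b)"
  define F where "F = sup_norm ({0..T} \<times> UNIV \<times> A \<times> B) (\<lambda>(t, x, a, b). f t x a b)"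
  define G where "G = sup_norm UNIV g"
  define D where "D = data_bound c f A B T"
  have cC: "\<bar>c t x a b\<bar> \<le> C" if "t \<in> {0..T}" "a \<in> A" "b \<in> B" for t x a b
    using norm_le_sup_norm[OF c_bounded, of "(t, x, a, b)"] that by (simp add: C_def)
  have fF: "norm (f t x a b) \<le> F" if "t \<in> {0..T}" "a \<in> A" "b \<in> B" for t x a b
    using norm_le_sup_norm[OF f_bounded, of "(t, x, a, b)"] that by (simp add: F_def)
  have gG: "\<bar>g x\<bar> \<le> G" for x
    using norm_le_sup_norm[OF g_bounded, of x] by (simp add: G_def)
  have CD: "C\<^sup>2 \<le> D" by (simp add: D_def data_bound_def C_def)
  have FD: "2 * F\<^sup>2 \<le> D"
  proof -
    have "1 * (2 * F\<^sup>2) \<le> real CARD('d) * (2 * F\<^sup>2)"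
      by (intro mult_right_mono) (simp_all add: Suc_leI)
    also have "\<dots> \<le> D" by (simp add: D_def data_bound_def F_def)
    finally show ?thesis by simp
  qed
  have D0: "0 \<le> D" using CD zero_le_power2[of C] by linarith

  \<comment> \<open>The dissipation has to be measured by this infimum: \<open>lam\<close> may be much smaller, and the step size
    restriction bounds \<open>\<tau>\<close> only in terms of the infimum.\<close>
  define \<mu> where "\<mu> = (MIN i. INF (t, x)\<in>{0..T} \<times> UNIV. diffusion \<sigma> i t x) + \<nu>"
  have \<mu>_le: "\<mu> \<le> diffusion \<sigma> i t x + \<nu>" if "t \<in> {0..T}" for i t x
  proof -
    have "(MIN i. INF (t, x)\<in>{0..T} \<times> UNIV. diffusion \<sigma> i t x)
        \<le> (INF (t, x)\<in>{0..T} \<times> UNIV. diffusion \<sigma> i t x)"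
      by (rule Min_le) auto
    also have "\<dots> \<le> (case (t, x) of (t, x) \<Rightarrow> diffusion \<sigma> i t x)"
      using that by (intro cINF_lower bdd_belowI2[where m = 0]) (auto simp: diffusion_def)
    finally show ?thesis by (simp add: \<mu>_def)
  qed
  have lam_\<mu>: "lam \<le> \<mu>"
  proof -
    have "lam - \<nu> \<le> (INF (t, x)\<in>{0..T} \<times> UNIV. diffusion \<sigma> i t x)" for i
      using ellipticity T_pos by (intro cINF_greatest) (auto simp: algebra_simps)
    then show ?thesis by (auto simp: \<mu>_def le_diff_eq[symmetric] diff_le_eq[symmetric])
  qed
  have D\<mu>: "96 * \<tau> * D \<le> \<mu>" using step_data by (simp add: \<mu>_def D_def)

  have cfl': "\<tau> * (\<Sum>i\<in>UNIV. diffusion \<sigma> i t x + \<nu>) \<le> h\<^sup>2"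
    if "t \<in> time_grid \<tau> T" "x \<in> space_grid h" for t x
  proof -
    have "diffusion \<sigma> i t x \<le> Lam" if "t \<in> {0..T}" for i t x
      using ellipticity that nu_nonneg by (smt (verit))
    then have "bdd_above ((\<lambda>(t, x). \<Sum>i\<in>UNIV. diffusion \<sigma> i t x) ` st_grid \<tau> h T)"
      using grid_T
      by (intro bdd_aboveI2[where M = "\<Sum>i\<in>(UNIV::'d set). Lam"])
        (auto simp: st_grid_def simp del: sum_constant intro!: sum_mono)
    then have "(\<Sum>i\<in>UNIV. diffusion \<sigma> i t x)
        \<le> (SUP (t, x)\<in>st_grid \<tau> h T. \<Sum>i\<in>UNIV. diffusion \<sigma> i t x)"
      using that by (intro cSUP_upper2[where x = "(t, x)"]) (auto simp: st_grid_def)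
    then have "(\<Sum>i\<in>UNIV. diffusion \<sigma> i t x + \<nu>) \<le> h\<^sup>2 / \<tau>"
      using cfl by (simp add: sum.distrib)
    then show ?thesis using tau_range by (simp add: field_simps)
  qed

  \<comment> \<open>The rate is the exponent in the constant, and it gives
    \<open>(\<tau> + 1 / K) D \<le> \<mu> / 96 + \<mu> / 48 = \<mu> / 32\<close>. For \<open>D = 0\<close> it would be \<open>0\<close>, which Young's inequality
    does not admit; but then \<open>F = 0\<close>, and the error vanishes whatever the rate is.\<close>
  define K where "K = (if D = 0 then 1 else 48 * D / lam)"
  have K0: "0 < K" using D0 lam_bounds by (simp add: K_def)
  interpret explicit_scheme h \<tau> K \<mu> N "\<lambda>k x i. diffusion \<sigma> i (s k) x + \<nu>"
    using h_range tau_range K0 lam_bounds lam_\<mu> \<mu>_le s_T cfl' s_grid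
    by unfold_locales (auto simp: less_imp_le)
  have F_small: "(\<tau> + 1 / K) * (2 * F\<^sup>2) \<le> \<mu> / 32"
  proof (cases "D = 0")
    case True
    then show ?thesis using FD \<mu>_pos zero_le_power2[of F] by simp
  next
    case False
    then have "(\<tau> + 1 / K) * (2 * F\<^sup>2) \<le> (\<tau> + 1 / K) * D"
      using K_pos \<tau>_pos by (intro mult_left_mono FD) auto
    also have "\<dots> = \<tau> * D + lam / 48" using False by (simp add: K_def field_simps)
    also have "\<dots> \<le> \<mu> / 32" using D\<mu> lam_\<mu> by simp
    finally show ?thesis .
  qed

  define H where "H k x = hamiltonian c f A B (s k) x (grad_slice h (V (s k)) x)" for k x
  define R where
    "R n k x = lagrangian c f (s k) x (grad_slice h (Vn n (s k)) x) (\<alpha> n (s k) x) (\<beta> n (s k) x)"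
    for n k x
  define e where "e n k x = Vn n (s k) x - V (s k) x" for n k x
  have V_step: "V (s (Suc k)) x = avg k (V (s k)) x + \<tau> * H k x"
    if "k < N" "x \<in> space_grid h" for k x
    unfolding s_Suc H_def using solves_scheme_step[OF V_solves \<tau>_pos s_pos[OF that(1)] that(2)] by simp
  have Vn_step: "Vn n (s (Suc k)) x = avg k (Vn n (s k)) x + \<tau> * R n k x"
    if "k < N" "x \<in> space_grid h" for n k x
  proof -
    have "solves_scheme \<sigma> g T \<tau> h \<nu>
        (\<lambda>t x p. lagrangian c f t x p (\<alpha> n t x) (\<beta> n t x)) (Vn n)"
      using PI unfolding policy_iteration_def by blast
    from solves_scheme_step[OF this \<tau>_pos s_pos[OF that(1)] that(2)]
    show ?thesis unfolding s_Suc R_def by simp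
  qed
  have s0: "s 0 = T" by (simp add: s_def)
  have V0: "V (s 0) x = g x" "Vn n (s 0) x = g x" if "x \<in> space_grid h" for n x
    using V_solves PI that unfolding policy_iteration_def solves_scheme_def s0 by blast+
  have e_step: "e n (Suc k) x = avg k (e n k) x + \<tau> * (R n k x - H k x)"
    if "k < N" "x \<in> space_grid h" for n k x
    using scheme_avg_lincomb[of h \<tau> "\<lambda>i. diffusion \<sigma> i (s k) x + \<nu>" 1 "Vn n (s k)" "- 1" "V (s k)" x]
    by (simp add: e_def[abs_def] V_step[OF that] Vn_step[OF that] algebra_simps)
  have grad_e: "grad_slice h (e n k) x = grad_slice h (Vn n (s k)) x - grad_slice h (V (s k)) x"
    for n k x unfolding e_def[abs_def] by (rule grad_slice_diff)

  have residual: "\<bar>R (Suc n) k x - H k x\<bar>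
      \<le> F * (norm (grad_slice h (e (Suc n) k) x) + 2 * norm (grad_slice h (e n k) x))"
    if k: "k < N" "x \<in> space_grid h" for n k x
  proof -
    let ?t = "s k" and ?q = "grad_slice h (Vn n (s k)) x"
    have t: "?t \<in> {0..T}" and "(?t, x) \<in> st_grid \<tau> h T"
      using s_T[of k] s_grid[of k] k by (auto simp: st_grid_def)
    then have amin: "\<And>b. b \<in> B \<Longrightarrow>
          is_arg_min (\<lambda>a. lagrangian c f ?t x ?q a b) (\<lambda>a. a \<in> A) (\<alpha>s (Suc n) ?t x b)"
      and bmax: "is_arg_max (\<lambda>b. lagrangian c f ?t x ?q (\<alpha>s (Suc n) ?t x b) b) (\<lambda>b. b \<in> B)
          (\<beta> (Suc n) ?t x)"
      and \<alpha>_eq: "\<alpha> (Suc n) ?t x = \<alpha>s (Suc n) ?t x (\<beta> (Suc n) ?t x)"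
      using PI unfolding policy_iteration_def grad_h_eq_grad_slice by blast+
    have bB: "\<beta> (Suc n) ?t x \<in> B" using bmax by (simp add: is_arg_max_def)
    have aA: "\<alpha> (Suc n) ?t x \<in> A" using amin[OF bB] by (simp add: is_arg_min_def \<alpha>_eq)
    have "hamiltonian c f A B ?t x ?q = lagrangian c f ?t x ?q (\<alpha> (Suc n) ?t x) (\<beta> (Suc n) ?t x)"
      unfolding \<alpha>_eq by (rule hamiltonian_eq_lagrangian[OF amin bmax])
    from policy_residual_le[OF ne cC[OF t] fF[OF t] this aA bB]
    show ?thesis unfolding R_def H_def grad_e by blast
  qed
  have error: "(e (Suc n) k x)\<^sup>2 + 31 / 32 * \<mu> * duhamel (grad_sq (e (Suc n))) k x
      \<le> (\<tau> + 1 / K) * (8 * F\<^sup>2) * duhamel (grad_sq (e n)) k x"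
    if "k \<le> N" "x \<in> space_grid h" for n k x
    by (rule policy_error_step[OF F_small _ e_step residual that]) (auto simp: e_def V0)

  have bound: "(e (Suc n) k x)\<^sup>2 \<le> const_Ch c f g A B T lam / 2 ^ (Suc n + 1)"
    if k: "k \<le> N" "x \<in> space_grid h" for n k x
  proof -
    have Ch: "const_Ch c f g A B T lam / 2 ^ (Suc n + 1)
        = 3 * (exp (48 * D / lam * T) * (G\<^sup>2 + T * lam / 12)) / 2 ^ n"
      by (simp add: const_Ch_def const_C1_def D_def G_def field_simps)
    show ?thesis
    proof (cases "D = 0")
      case True
      then have "F\<^sup>2 = 0" using FD zero_le_power2[of F] by linarith
      then have "(\<tau> + 1 / K) * (8 * F\<^sup>2) * duhamel (grad_sq (e n)) k x = 0" by simp
      moreover have "0 \<le> 31 / 32 * \<mu> * duhamel (grad_sq (e (Suc n))) k x"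
        using \<mu>_pos k by (intro mult_nonneg_nonneg duhamel_nonneg) auto
      ultimately have "(e (Suc n) k x)\<^sup>2 \<le> 0" using error[OF k, of n] by linarith
      also have "0 \<le> const_Ch c f g A B T lam / 2 ^ (Suc n + 1)"
        unfolding Ch using T_pos lam_bounds by simp
      finally show ?thesis .
    next
      case False
      then have K: "K = 48 * D / lam" by (simp add: K_def)
      define M where
        "M = (1 + K * \<tau>) ^ k * G\<^sup>2 + (\<tau> + 1 / K) * (2 * C\<^sup>2) * (((1 + K * \<tau>) ^ k - 1) / K)"
      have V_grad: "31 / 32 * \<mu> * duhamel (grad_sq (\<lambda>k. V (s k))) k x \<le> M"
        unfolding M_def
      proof (rule solution_gradient_bound[OF F_small _ V_step _ k])
        show "\<bar>V (s 0) x\<bar> \<le> G" if "x \<in> space_grid h" for x using that gG by (simp add: V0)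
        show "\<bar>H k x\<bar> \<le> C + F * norm (grad_slice h (V (s k)) x)" if "k < N" for k x
          unfolding H_def using that s_T[of k] by (intro abs_hamiltonian_le ne cC fF) auto
      qed
      have V0_grad: "31 / 32 * \<mu> * duhamel (grad_sq (\<lambda>k. Vn 0 (s k))) k x \<le> M"
        unfolding M_def
      proof (rule solution_gradient_bound[OF F_small _ Vn_step _ k])
        show "\<bar>Vn 0 (s 0) x\<bar> \<le> G" if "x \<in> space_grid h" for x using that gG by (simp add: V0)
        show "\<bar>R 0 k x\<bar> \<le> C + F * norm (grad_slice h (Vn 0 (s k)) x)" if "k < N" for k x
          unfolding R_def using that s_T[of k] alpha0(2) beta0(2)
          by (intro abs_lagrangian_le cC fF) auto
      qed
      have "(e (Suc n) k x)\<^sup>2 \<le> M / 2 ^ n"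
        by (rule policy_error_bound[where e = e, OF F_small error[OF k] _ V0_grad V_grad k])
          (simp add: e_def[abs_def])
      also have "\<dots> \<le> exp (K * T) * (G\<^sup>2 + T * lam / 12) / 2 ^ n"
      proof (intro divide_right_mono)
        have "2 * C\<^sup>2 \<le> K * lam / 24" using CD lam_bounds by (simp add: K)
        moreover have "real k * \<tau> \<le> T" using k \<tau>_pos by (simp add: NT)
        ultimately show "M \<le> exp (K * T) * (G\<^sup>2 + T * lam / 12)"
          unfolding M_def using \<tau>T lam_bounds by (intro growth_bound) auto
      qed simp
      also have "\<dots> \<le> const_Ch c f g A B T lam / 2 ^ (Suc n + 1)"
        unfolding Ch K using T_pos lam_bounds by (intro divide_right_mono) auto
      finally show ?thesis .
    qed
  qed

  have grid_bound: "(case z of (t, x) \<Rightarrow> \<bar>Vn n t x - V t x\<bar>\<^sup>2) \<le> const_Ch c f g A B T lam / 2 ^ (n + 1)"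
    if n: "1 \<le> n" and z_grid: "z \<in> st_grid \<tau> h T" for n z
  proof -
    obtain t x where z: "z = (t, x)" "t \<in> time_grid \<tau> T" "x \<in> space_grid h"
      using z_grid by (auto simp: st_grid_def)
    obtain k where k: "k \<le> N" "t = s k" using grid_s[OF z(2)] by blast
    obtain m where m: "n = Suc m" using n by (cases n) auto
    show ?thesis using bound[OF k(1) z(3), of m] unfolding z m k e_def by simp
  qed
  have "(T, 0) \<in> st_grid \<tau> h T"
    using s_grid[of 0] by (auto simp: st_grid_def space_grid_def s0 intro: exI[of _ 0])
  then have "st_grid \<tau> h T \<noteq> ({} :: (real \<times> (real^'d)) set)" by blast
  then show ?thesis
    using grid_bound by (intro allI impI conjI bdd_aboveI2 cSUP_least) blast+
qed

end
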